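(* Let $f(x)=x^\top Qx+q^\top x$ with $Q\in\mathbb{R}^{n\times n}$ symmetric and positive semidefinite and $q\in\mathbb{R}^n$, and let $X^i\subseteq\mathbb{R}^{n_i}$, $i=1,\ldots,m$, be non-empty, compact and convex, with $n=\sum_{i=1}^m n_i$. If $c>\lambda^{\max}_{Q_z}$, then for any initial point $x_0\in X=X^1\times\cdots\times X^m$ the sequence $(x_k)_{k\ge 0}$ generated by the regularized Jacobi iteration $$x^i_{k+1}=\arg\min_{z^i\in X^i}\left\{f(z^i,x^{-i}_k)+c\|z^i-x^i_k\|^2\right\},\quad i=1,\ldots,m,\ k\ge 0,$$ converges to a minimizer of the problem $\mathcal{P}:\ \min_{x\in X} f(x)$.
   Context: Vectors $x\in\mathbb{R}^n$ are partitioned as $x=(x^1,\ldots,x^m)$ with $x^i\in\mathbb{R}^{n_i}$. The vector $x^{-i}\in\mathbb{R}^{n-n_i}$ collects all blocks of $x$ except the $i$-th, and $f(z^i,x^{-i})$ is the value of $f$ when the $i$-th block is $z^i$ and the other blocks are those of $x$. $\|\cdot\|$ is the Euclidean norm. Let $Q_{i,i}\in\mathbb{R}^{n_i\times n_i}$ be the $i$-th diagonal block of $Q$ (rows and columns corresponding to $x^i$), let $Q_d$ be the block diagonal matrix with diagonal blocks $Q_{1,1},\ldots,Q_{m,m}$, and let $Q_z=Q-Q_d$. $\lambda^{\max}_{Q_z}$ is the maximum eigenvalue of the symmetric matrix $Q_z$; it is non-negative since $Q_z$ has zero trace. Since $c>0$, each local minimization problem in the iteration has a unique minimizer. *)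

theory Defs
  imports "HOL-Analysis.Analysis"
begin

text \<open>
  The partition of the coordinates of a vector of type \<^typ>\<open>real^'n\<close> into blocks is given by a map
  \<open>blk :: 'n \<Rightarrow> 'm\<close> sending each coordinate to the index of its block, so that block \<open>i\<close> has
  dimension \<open>n\<^sub>i = card {j. blk j = i}\<close> and the \<open>n\<^sub>i\<close> add up to \<open>CARD('n)\<close>. Since the \<open>n\<^sub>i\<close> may
  differ, the space of the \<open>i\<close>-th block is represented by the coordinate subspace
  \<open>block_space blk i\<close> of \<^typ>\<open>real^'n\<close>, to which it is linearly isometric by padding with zeros.
\<close>

definition block_space :: "('n \<Rightarrow> 'm) \<Rightarrow> 'm \<Rightarrow> (real^'n) set" where
  "block_space blk i = {z. \<forall>j. blk j \<noteq> i \<longrightarrow> z $ j = 0}"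

definition block :: "('n \<Rightarrow> 'm) \<Rightarrow> 'm \<Rightarrow> real^'n \<Rightarrow> real^'n" where
  "block blk i x = (\<chi> j. if blk j = i then x $ j else 0)"

text \<open>The vector \<open>(z\<^sup>i, x\<^sup>-\<^sup>i)\<close>.\<close>

definition replace_block :: "('n \<Rightarrow> 'm) \<Rightarrow> 'm \<Rightarrow> real^'n \<Rightarrow> real^'n \<Rightarrow> real^'n" where
  "replace_block blk i z x = (\<chi> j. if blk j = i then z $ j else x $ j)"

definition block_product :: "('n \<Rightarrow> 'm) \<Rightarrow> ('m \<Rightarrow> (real^'n) set) \<Rightarrow> (real^'n) set" where
  "block_product blk X = {x. \<forall>i. block blk i x \<in> X i}"

definition block_diag :: "('n \<Rightarrow> 'm) \<Rightarrow> real^'n^'n \<Rightarrow> real^'n^'n" where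
  "block_diag blk Q = (\<chi> j k. if blk j = blk k then Q $ j $ k else 0)"

definition pos_semidef :: "real^'n^'n \<Rightarrow> bool" where
  "pos_semidef A \<longleftrightarrow> (\<forall>x. 0 \<le> x \<bullet> (A *v x))"

definition eigenvalue :: "real^'n^'n \<Rightarrow> real \<Rightarrow> bool" where
  "eigenvalue A l \<longleftrightarrow> (\<exists>v. v \<noteq> 0 \<and> A *v v = l *\<^sub>R v)"

text \<open>Meaningful for symmetric matrices, whose set of real eigenvalues is finite and non-empty.\<close>

definition max_eigenvalue :: "real^'n^'n \<Rightarrow> real" where
  "max_eigenvalue A = Max {l. eigenvalue A l}"

definition quad_fun :: "real^'n^'n \<Rightarrow> real^'n \<Rightarrow> real^'n \<Rightarrow> real" where
  "quad_fun Q q x = x \<bullet> (Q *v x) + q \<bullet> x"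

definition jacobi_block ::
  "('n \<Rightarrow> 'm) \<Rightarrow> ('m \<Rightarrow> (real^'n) set) \<Rightarrow> (real^'n \<Rightarrow> real) \<Rightarrow> real \<Rightarrow> real^'n \<Rightarrow> 'm \<Rightarrow> real^'n" where
  "jacobi_block blk X f c x i =
     arg_min (\<lambda>z. f (replace_block blk i z x) + c * (norm (z - block blk i x))\<^sup>2) (\<lambda>z. z \<in> X i)"

text \<open>All blocks are updated simultaneously: coordinate \<open>j\<close> is read off the new block \<open>blk j\<close>.\<close>

definition jacobi_step ::
  "('n \<Rightarrow> 'm) \<Rightarrow> ('m \<Rightarrow> (real^'n) set) \<Rightarrow> (real^'n \<Rightarrow> real) \<Rightarrow> real \<Rightarrow> real^'n \<Rightarrow> real^'n" where
  "jacobi_step blk X f c x = (\<chi> j. jacobi_block blk X f c x (blk j) $ j)"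

primrec jacobi_seq ::
  "('n \<Rightarrow> 'm) \<Rightarrow> ('m \<Rightarrow> (real^'n) set) \<Rightarrow> (real^'n \<Rightarrow> real) \<Rightarrow> real \<Rightarrow> real^'n \<Rightarrow> nat \<Rightarrow> real^'n" where
  "jacobi_seq blk X f c x0 0 = x0"
| "jacobi_seq blk X f c x0 (Suc k) = jacobi_step blk X f c (jacobi_seq blk X f c x0 k)"

end

theory Submission
  imports Defs
begin

text \<open>
  Write \<open>M = c I - Q\<^sub>z\<close> and let \<open>y\<close> be the Jacobi update of \<open>x\<close>. Adding up the first-order optimality
  conditions of the block subproblems gives, for every \<open>w\<close> in the product set,
  \<open>0 \<le> (w - y) \<bullet> (2 Q x + q + 2 Q\<^sub>d (y - x) + 2 c (y - x))\<close>. Replacing \<open>Q\<^sub>d\<close> by \<open>Q - Q\<^sub>z\<close> turns this into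
  \<open>0 \<le> (w - y) \<bullet> (\<nabla>f y + 2 M (y - x))\<close>, the optimality condition of a proximal step for \<open>f\<close> in
  the metric given by \<open>M\<close>. The simultaneous block updates are thus an exact proximal point method, and
  the condition on \<open>c\<close> says that \<open>M\<close> is positive definite (\<open>inner_le_max_eigenvalue\<close>), so that
  the metric is a genuine one.

  Convexity of \<open>f\<close> turns the condition into the three-point inequality
  \<open>f y + |y - x|\<^sub>M\<^sup>2 + |y - w|\<^sub>M\<^sup>2 \<le> f w + |x - w|\<^sub>M\<^sup>2\<close> (\<open>jacobi_step_three_point\<close>). With \<open>w\<close> a minimizer
  it shows that the distances to \<open>w\<close> decrease and that the gaps \<open>f x\<^sub>k - f w\<close> tend to 0, being
  bounded by the decrements of the squared distance. By compactness some subsequence converges,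
  necessarily to a minimizer; as the distances to that minimizer decrease as well, the whole
  sequence converges to it (\<open>proximal_sequence_converges\<close>).
\<close>

section \<open>Rayleigh bound for symmetric matrices\<close>

lemma inner_matrix_symmetric:
  fixes A :: "real^'n^'n"
  assumes "transpose A = A"
  shows "u \<bullet> (A *v v) = v \<bullet> (A *v u)"
  by (metis assms dot_lmul_matrix inner_commute vector_transpose_matrix)

text \<open>
  All first-order conditions below come from this one: along a segment starting at a minimizer, the
  increase of a quadratic objective is \<open>t b + t\<^sup>2 a\<close>, with \<open>b\<close> the directional derivative.
\<close>

lemma linear_coefficient_nonneg:
  fixes a b :: real
  assumes "\<And>t. 0 < t \<Longrightarrow> t \<le> 1 \<Longrightarrow> 0 \<le> t * b + t\<^sup>2 * a"
  shows "0 \<le> b"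
proof (rule ccontr)
  assume "\<not> 0 \<le> b"
  then have b: "b < 0" by simp
  define t where "t = min 1 (- b / (\<bar>a\<bar> + 1))"
  have t: "0 < t" "t \<le> 1"
    using b by (auto simp: t_def divide_simps)
  have "t \<le> - b / (\<bar>a\<bar> + 1)"
    by (simp add: t_def)
  then have "t * (\<bar>a\<bar> + 1) \<le> - b"
    by (subst (asm) pos_le_divide_eq) auto
  moreover have "t * a \<le> t * \<bar>a\<bar>"
    using t by (intro mult_left_mono) auto
  ultimately have "b + t * a < 0"
    using t(1) unfolding distrib_left by linarith
  then have "t * (b + t * a) < 0"
    using t by (simp add: mult_pos_neg)
  moreover have "0 \<le> t * (b + t * a)"
    using assms[OF t] by (simp add: algebra_simps power2_eq_square)
  ultimately show False by simp
qed

text \<open>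
  Eigenvectors for distinct eigenvalues are orthogonal, hence independent. Finiteness is what
  makes the \<^const>\<open>Max\<close> in \<^const>\<open>max_eigenvalue\<close> an upper bound of the eigenvalues.
\<close>

lemma finite_eigenvalues_symmetric:
  fixes A :: "real^'n^'n"
  assumes sym: "transpose A = A"
  shows "finite {l. eigenvalue A l}"
proof -
  define V where "V l = (SOME v. v \<noteq> 0 \<and> A *v v = l *\<^sub>R v)" for l
  have V: "V l \<noteq> 0" "A *v V l = l *\<^sub>R V l" if "eigenvalue A l" for l
    using someI_ex[of "\<lambda>v. v \<noteq> 0 \<and> A *v v = l *\<^sub>R v"] that
    unfolding V_def eigenvalue_def by auto
  have orth: "V l \<bullet> V l' = 0" if "eigenvalue A l" "eigenvalue A l'" "l \<noteq> l'" for l l'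
    using inner_matrix_symmetric[OF sym, of "V l" "V l'"] V(2)[OF that(1)] V(2)[OF that(2)] that(3)
    by (simp add: inner_commute)
  have inj: "inj_on V {l. eigenvalue A l}"
    using orth V(1) by (metis (mono_tags, lifting) inj_onI inner_eq_zero_iff mem_Collect_eq)
  have "independent (V ` {l. eigenvalue A l})"
  proof (rule pairwise_orthogonal_independent)
    show "pairwise orthogonal (V ` {l. eigenvalue A l})"
      using orth by (auto simp: pairwise_def orthogonal_def)
    show "0 \<notin> V ` {l. eigenvalue A l}"
      using V(1) by auto
  qed
  then show ?thesis
    using independent_imp_finite finite_imageD[OF _ inj] by blast
qed

text \<open>The maximum of the quadratic form over the unit sphere is attained at an eigenvector.\<close>

lemma inner_le_max_eigenvalue:
  fixes A :: "real^'n^'n"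
  assumes sym: "transpose A = A"
  shows "x \<bullet> (A *v x) \<le> max_eigenvalue A * (x \<bullet> x)"
proof -
  have cont: "continuous_on (sphere 0 1) (\<lambda>x. x \<bullet> (A *v x))"
    by (intro continuous_intros linear_continuous_on_compose[OF continuous_on_id]) simp
  have "axis undefined 1 \<in> sphere (0::real^'n) 1"
    by (simp add: norm_axis_1)
  then obtain v :: "real^'n" where v: "v \<in> sphere 0 1"
    and vmax: "\<And>u. u \<in> sphere 0 1 \<Longrightarrow> u \<bullet> (A *v u) \<le> v \<bullet> (A *v v)"
    using continuous_attains_sup[OF compact_sphere _ cont] by blast
  define m where "m = v \<bullet> (A *v v)"
  have vv: "v \<bullet> v = 1"
    using v by (simp add: norm_eq_1)
  have bound: "u \<bullet> (A *v u) \<le> m * (u \<bullet> u)" for u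
  proof (cases "u = 0")
    case False
    define s where "s = u /\<^sub>R norm u"
    have "s \<in> sphere 0 1"
      using False by (simp add: s_def)
    moreover have "u = norm u *\<^sub>R s"
      using False by (simp add: s_def)
    ultimately have "u \<bullet> (A *v u) = (norm u)\<^sup>2 * (s \<bullet> (A *v s))" "s \<bullet> (A *v s) \<le> m"
      using vmax[of s]
      by (metis inner_scaleR_left inner_scaleR_right matrix_vector_mult_scaleR mult.assoc
          power2_eq_square, simp add: m_def)
    then show ?thesis
      using mult_left_mono[of "s \<bullet> (A *v s)" m "(norm u)\<^sup>2"]
      by (simp add: mult.commute power2_norm_eq_inner)
  qed simp
  \<comment> \<open>\<open>m (u \<bullet> u) - u \<bullet> A u\<close> is non-negative and vanishes at \<open>v\<close>; moving from \<open>v\<close> in the direction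
    of the residual \<open>g\<close> would make it negative to first order unless \<open>g = 0\<close>.\<close>
  define g where "g = A *v v - m *\<^sub>R v"
  have "0 \<le> - 2 * (g \<bullet> g)"
  proof (rule linear_coefficient_nonneg)
    fix t :: real
    have gvA: "v \<bullet> (A *v g) = g \<bullet> (A *v v)"
      by (rule inner_matrix_symmetric[OF sym])
    have gg: "g \<bullet> g = g \<bullet> (A *v v) - m * (g \<bullet> v)"
      by (subst (2) g_def) (simp add: inner_diff_right)
    have "(v + t *\<^sub>R g) \<bullet> (A *v (v + t *\<^sub>R g)) \<le> m * ((v + t *\<^sub>R g) \<bullet> (v + t *\<^sub>R g))"
      by (rule bound)
    then have "m + 2 * t * (g \<bullet> (A *v v)) + t\<^sup>2 * (g \<bullet> (A *v g))
        \<le> m * (1 + 2 * t * (g \<bullet> v) + t\<^sup>2 * (g \<bullet> g))"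
      using vv gvA
      by (simp add: inner_add_left inner_add_right matrix_vector_right_distrib
          matrix_vector_mult_scaleR power2_eq_square inner_commute[of v g] m_def[symmetric]
          algebra_simps)
    then show "0 \<le> t * (- 2 * (g \<bullet> g)) + t\<^sup>2 * (m * (g \<bullet> g) - g \<bullet> (A *v g))"
      unfolding gg by (simp add: algebra_simps)
  qed
  then have "g \<bullet> g = 0"
    by (metis inner_ge_zero mult_minus_left neg_0_le_iff_le mult_le_cancel_left_pos
        mult_zero_right order_antisym zero_less_numeral)
  then have "A *v v = m *\<^sub>R v"
    by (simp add: g_def)
  moreover have "v \<noteq> 0"
    using vv by auto
  ultimately have "eigenvalue A m"
    by (auto simp: eigenvalue_def)
  then have "m \<le> max_eigenvalue A"
    unfolding max_eigenvalue_def using finite_eigenvalues_symmetric[OF sym] by simp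
  then have "m * (x \<bullet> x) \<le> max_eigenvalue A * (x \<bullet> x)"
    by (intro mult_right_mono) auto
  with bound[of x] show ?thesis by linarith
qed

section \<open>Block decomposition\<close>

lemma sum_block:
  fixes blk :: "'n::finite \<Rightarrow> 'm::finite"
  shows "(\<Sum>i\<in>UNIV. block blk i x) = x"
  by (simp add: vec_eq_iff block_def)

lemma block_diff: "block blk i (u - v) = block blk i u - block blk i v"
  by (simp add: vec_eq_iff block_def)

lemma sum_inner_block:
  fixes blk :: "'n::finite \<Rightarrow> 'm::finite"
  shows "(\<Sum>i\<in>UNIV. block blk i u \<bullet> a) = u \<bullet> a"
  by (simp flip: inner_sum_left add: sum_block)

lemma inner_block_block: "block blk i u \<bullet> block blk i v = block blk i u \<bullet> v"
  by (auto simp: inner_vec_def block_def intro!: sum.cong)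

lemma inner_block_matrix_block:
  "block blk i u \<bullet> (Q *v block blk i v) = block blk i u \<bullet> (block_diag blk Q *v v)"
  by (auto simp: inner_vec_def block_def block_diag_def matrix_vector_mult_def intro!: sum.cong)

lemma replace_block_eq_add:
  assumes "z \<in> block_space blk i"
  shows "replace_block blk i z x = x + (z - block blk i x)"
  using assms by (auto simp: vec_eq_iff replace_block_def block_def block_space_def)

lemma continuous_on_block: "continuous_on S (block blk i :: real^'n \<Rightarrow> real^'n)"
  unfolding block_def
proof (intro continuous_on_vec_lambda)
  show "continuous_on S (\<lambda>x::real^'n. if blk j = i then x $ j else 0)" for j
    by (cases "blk j = i") (auto intro: continuous_intros)
qed

lemma compact_block_product:
  fixes X :: "'m::finite \<Rightarrow> (real^'n) set"
  assumes "\<And>i. X i \<subseteq> block_space blk i" "\<And>i. compact (X i)"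
  shows "compact (block_product blk X)"
proof -
  have "closed (block_product blk X)"
  proof -
    have "block_product blk X = (\<Inter>i. block blk i -` X i)"
      by (auto simp: block_product_def)
    moreover have "closed (block blk i -` X i)" for i
      using continuous_closed_vimage[of "X i" "block blk i"] assms(2)[of i]
        continuous_on_block[of UNIV blk i]
      by (simp add: compact_imp_closed continuous_on_eq_continuous_at)
    ultimately show ?thesis by auto
  qed
  moreover have "bounded (block_product blk X)"
  proof -
    have "\<forall>i. \<exists>B. \<forall>z\<in>X i. norm z \<le> B"
      using assms(2) compact_imp_bounded bounded_iff by metis
    then obtain B where B: "\<And>i z. z \<in> X i \<Longrightarrow> norm z \<le> B i" by metis
    have "norm x \<le> (\<Sum>i\<in>UNIV. B i)" if "x \<in> block_product blk X" for x
    proof -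
      have "norm x = norm (\<Sum>i\<in>UNIV. block blk i x)" by (simp add: sum_block)
      also have "\<dots> \<le> (\<Sum>i\<in>UNIV. norm (block blk i x))" by (rule norm_sum)
      also have "\<dots> \<le> (\<Sum>i\<in>UNIV. B i)"
        using that B by (intro sum_mono) (auto simp: block_product_def)
      finally show ?thesis .
    qed
    then show ?thesis by (auto simp: bounded_iff)
  qed
  ultimately show ?thesis by (simp add: compact_eq_bounded_closed)
qed

section \<open>The Jacobi step as a proximal step\<close>

lemma quad_fun_add:
  assumes "transpose Q = Q"
  shows "quad_fun Q q (x + d) = quad_fun Q q x + d \<bullet> (2 *\<^sub>R (Q *v x) + q) + d \<bullet> (Q *v d)"
  using inner_matrix_symmetric[OF assms, of x d]
  by (simp add: quad_fun_def inner_add_left inner_add_right matrix_vector_right_distrib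
      inner_commute algebra_simps)

lemma continuous_on_quad_fun: "continuous_on S (quad_fun Q q)"
  unfolding quad_fun_def
  by (intro continuous_intros linear_continuous_on_compose[OF continuous_on_id]) simp

text \<open>
  Compactness of the factor provides a minimizer, so the choice made by \<^const>\<open>arg_min\<close> in
  \<^const>\<open>jacobi_block\<close> does pick one.
\<close>

lemma jacobi_block_is_arg_min:
  assumes "X i \<noteq> {}" "compact (X i)" "X i \<subseteq> block_space blk i"
  shows "is_arg_min (\<lambda>z. quad_fun Q q (replace_block blk i z x) + c * (norm (z - block blk i x))\<^sup>2)
           (\<lambda>z. z \<in> X i) (jacobi_block blk X (quad_fun Q q) c x i)"
proof -
  let ?\<phi> = "\<lambda>z. quad_fun Q q (replace_block blk i z x) + c * (norm (z - block blk i x))\<^sup>2"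
  have "continuous_on (X i) (\<lambda>z. quad_fun Q q (x + (z - block blk i x)) + c * (norm (z - block blk i x))\<^sup>2)"
    by (intro continuous_intros continuous_on_compose2[OF continuous_on_quad_fun[of UNIV]]) auto
  then have "continuous_on (X i) ?\<phi>"
    by (rule continuous_on_eq) (use assms(3) in \<open>auto simp: replace_block_eq_add\<close>)
  then have "\<exists>z\<in>X i. \<forall>w\<in>X i. ?\<phi> z \<le> ?\<phi> w"
    using continuous_attains_inf assms by blast
  then have "\<exists>z. is_arg_min ?\<phi> (\<lambda>z. z \<in> X i) z"
    by (auto simp: is_arg_min_linorder)
  then show ?thesis
    unfolding jacobi_block_def arg_min_def by (rule someI_ex)
qed

lemma block_jacobi_step:
  assumes "jacobi_block blk X f c x i \<in> X i" "X i \<subseteq> block_space blk i"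
  shows "block blk i (jacobi_step blk X f c x) = jacobi_block blk X f c x i"
  using assms by (auto simp: vec_eq_iff block_def jacobi_step_def block_space_def)

text \<open>
  By convexity of the factor the segment from \<open>y\<close> to \<open>w\<close> is feasible, so the derivative of the
  subproblem's objective at \<open>y\<close> in the direction \<open>w - y\<close> is non-negative.
\<close>

lemma jacobi_block_variational_inequality:
  fixes Q :: "real^'n^'n"
  assumes sym: "transpose Q = Q"
    and X: "X i \<subseteq> block_space blk i" "X i \<noteq> {}" "compact (X i)" "convex (X i)"
    and w: "w \<in> X i"
    and y_def: "y = jacobi_block blk X (quad_fun Q q) c x i"
  shows "0 \<le> (w - y) \<bullet> (2 *\<^sub>R (Q *v x) + q + 2 *\<^sub>R (Q *v (y - block blk i x))
                + (2 * c) *\<^sub>R (y - block blk i x))"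
proof (rule linear_coefficient_nonneg)
  fix t :: real
  assume t: "0 < t" "t \<le> 1"
  let ?\<phi> = "\<lambda>z. quad_fun Q q (replace_block blk i z x) + c * (norm (z - block blk i x))\<^sup>2"
  let ?d = "y - block blk i x"
  let ?e = "w - y"
  have y: "y \<in> X i" and ymin: "\<And>z. z \<in> X i \<Longrightarrow> ?\<phi> y \<le> ?\<phi> z"
    using jacobi_block_is_arg_min[of X i, OF X(2,3,1)] unfolding y_def is_arg_min_linorder by blast+
  define z where "z = y + t *\<^sub>R ?e"
  have "z = (1 - t) *\<^sub>R y + t *\<^sub>R w"
    by (simp add: z_def algebra_simps)
  then have z: "z \<in> X i"
    using convexD_alt[OF X(4) y w] t by simp
  have \<phi>: "?\<phi> v = quad_fun Q q x + (v - block blk i x) \<bullet> (2 *\<^sub>R (Q *v x) + q)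
      + (v - block blk i x) \<bullet> (Q *v (v - block blk i x))
      + c * ((v - block blk i x) \<bullet> (v - block blk i x))" if "v \<in> X i" for v
    using that X(1) by (auto simp: replace_block_eq_add quad_fun_add[OF sym] power2_norm_eq_inner)
  have zd: "z - block blk i x = ?d + t *\<^sub>R ?e"
    by (simp add: z_def)
  have expand: "(d + t *\<^sub>R e) \<bullet> p + (d + t *\<^sub>R e) \<bullet> (Q *v (d + t *\<^sub>R e))
        + c * ((d + t *\<^sub>R e) \<bullet> (d + t *\<^sub>R e))
      = d \<bullet> p + d \<bullet> (Q *v d) + c * (d \<bullet> d)
        + t * (e \<bullet> (p + 2 *\<^sub>R (Q *v d) + (2 * c) *\<^sub>R d))
        + t\<^sup>2 * (e \<bullet> (Q *v e) + c * (e \<bullet> e))" for d e p :: "real^'n"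
    using inner_matrix_symmetric[OF sym, of d e]
    by (simp add: inner_add_left inner_add_right matrix_vector_right_distrib
        matrix_vector_mult_scaleR power2_eq_square inner_commute[of d e] algebra_simps)
  have "?\<phi> z = ?\<phi> y + t * (?e \<bullet> (2 *\<^sub>R (Q *v x) + q + 2 *\<^sub>R (Q *v ?d) + (2 * c) *\<^sub>R ?d))
      + t\<^sup>2 * (?e \<bullet> (Q *v ?e) + c * (?e \<bullet> ?e))"
    unfolding \<phi>[OF z] \<phi>[OF y] unfolding zd
    using expand[of ?d ?e "2 *\<^sub>R (Q *v x) + q"] by linarith
  then show "0 \<le> t * (?e \<bullet> (2 *\<^sub>R (Q *v x) + q + 2 *\<^sub>R (Q *v ?d) + (2 * c) *\<^sub>R ?d))
      + t\<^sup>2 * (?e \<bullet> (Q *v ?e) + c * (?e \<bullet> ?e))"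
    using ymin[OF z] by linarith
qed

text \<open>
  The block inequalities add up because the \<open>i\<close>-th one only sees the \<open>i\<close>-th diagonal block of
  \<open>Q\<close>; the sum collects these blocks into \<open>Q\<^sub>d = Q - Q\<^sub>z\<close>, and \<open>2 Q x + 2 Q\<^sub>d (y - x)\<close> is the same as
  \<open>2 Q y - 2 Q\<^sub>z (y - x)\<close>.
\<close>

lemma jacobi_step_variational_inequality:
  fixes Q :: "real^'n^'n" and blk :: "'n \<Rightarrow> 'm::finite"
  assumes sym: "transpose Q = Q"
    and X: "\<And>i. X i \<subseteq> block_space blk i" "\<And>i. X i \<noteq> {}" "\<And>i. compact (X i)" "\<And>i. convex (X i)"
    and w: "w \<in> block_product blk X"
    and y_def: "y = jacobi_step blk X (quad_fun Q q) c x"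
  shows "0 \<le> (w - y) \<bullet> (2 *\<^sub>R (Q *v y) + q
                + 2 *\<^sub>R (c *\<^sub>R (y - x) - (Q - block_diag blk Q) *v (y - x)))"
proof -
  have yb: "block blk i y = jacobi_block blk X (quad_fun Q q) c x i" for i
    unfolding y_def
    using jacobi_block_is_arg_min[where X = X and blk = blk and i = i] X
    by (intro block_jacobi_step) (auto simp: is_arg_min_def)
  have "0 \<le> block blk i (w - y) \<bullet> (2 *\<^sub>R (Q *v x) + q + 2 *\<^sub>R (block_diag blk Q *v (y - x))
          + (2 * c) *\<^sub>R (y - x))" for i
  proof -
    have "block blk i w \<in> X i"
      using w by (simp add: block_product_def)
    from jacobi_block_variational_inequality[OF sym X this yb]
    have "0 \<le> block blk i (w - y) \<bullet> (2 *\<^sub>R (Q *v x) + q + 2 *\<^sub>R (Q *v block blk i (y - x))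
          + (2 * c) *\<^sub>R block blk i (y - x))"
      by (simp only: block_diff)
    then show ?thesis
      by (simp only: inner_add_right inner_scaleR_right inner_block_matrix_block inner_block_block)
  qed
  then have "0 \<le> (\<Sum>i\<in>UNIV. block blk i (w - y) \<bullet>
      (2 *\<^sub>R (Q *v x) + q + 2 *\<^sub>R (block_diag blk Q *v (y - x)) + (2 * c) *\<^sub>R (y - x)))"
    by (intro sum_nonneg) auto
  moreover have "2 *\<^sub>R (Q *v x) + q + 2 *\<^sub>R (block_diag blk Q *v (y - x)) + (2 * c) *\<^sub>R (y - x)
      = 2 *\<^sub>R (Q *v y) + q + 2 *\<^sub>R (c *\<^sub>R (y - x) - (Q - block_diag blk Q) *v (y - x))"
    by (simp add: matrix_vector_mult_diff_rdistrib matrix_vector_mult_diff_distrib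
        scaleR_diff_right)
  ultimately show ?thesis
    by (simp only: sum_inner_block)
qed

lemma jacobi_step_in_block_product:
  assumes "\<And>i. X i \<subseteq> block_space blk i" "\<And>i. X i \<noteq> {}" "\<And>i. compact (X i)"
  shows "jacobi_step blk X (quad_fun Q q) c x \<in> block_product blk X"
  unfolding block_product_def
proof (intro CollectI allI)
  fix i
  have "jacobi_block blk X (quad_fun Q q) c x i \<in> X i"
    using jacobi_block_is_arg_min[of X i blk] assms by (auto simp: is_arg_min_def)
  then show "block blk i (jacobi_step blk X (quad_fun Q q) c x) \<in> X i"
    using block_jacobi_step assms(1) by metis
qed

text \<open>
  Besides convexity of \<open>f\<close>, this uses the polarization identity
  \<open>2 (w - y) \<bullet> M (y - x) = |x - w|\<^sub>M\<^sup>2 - |y - x|\<^sub>M\<^sup>2 - |y - w|\<^sub>M\<^sup>2\<close>.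
\<close>

lemma jacobi_step_three_point:
  fixes Q :: "real^'n^'n" and blk :: "'n \<Rightarrow> 'm::finite"
  assumes sym: "transpose Q = Q" and psd: "pos_semidef Q"
    and X: "\<And>i. X i \<subseteq> block_space blk i" "\<And>i. X i \<noteq> {}" "\<And>i. compact (X i)" "\<And>i. convex (X i)"
    and w: "w \<in> block_product blk X"
    and y_def: "y = jacobi_step blk X (quad_fun Q q) c x"
    and N_def: "N = (\<lambda>u. c * (u \<bullet> u) - u \<bullet> ((Q - block_diag blk Q) *v u))"
  shows "quad_fun Q q y + N (y - x) + N (y - w) \<le> quad_fun Q q w + N (x - w)"
proof -
  define A where "A = Q - block_diag blk Q"
  define d where "d = y - x"
  define e where "e = w - y"
  have "transpose A = A"
    using sym by (simp add: A_def block_diag_def transpose_def vec_eq_iff)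
  then have de: "d \<bullet> (A *v e) = e \<bullet> (A *v d)"
    by (rule inner_matrix_symmetric)
  have N_minus: "N (- u) = N u" for u
    by (simp add: N_def vec.neg)
  have "N (x - w) = N (d + e)"
    using N_minus[of "d + e"] by (simp add: d_def e_def)
  also have "\<dots> = N d + N e + 2 * (e \<bullet> (c *\<^sub>R d - A *v d))"
    using de by (simp add: N_def A_def[symmetric] inner_add_left inner_add_right inner_diff_right
        matrix_vector_right_distrib inner_commute[of d e] algebra_simps)
  finally have polar: "N (x - w) = N d + N e + 2 * (e \<bullet> (c *\<^sub>R d - A *v d))" .
  have Ne: "N (y - w) = N e"
    using N_minus[of e] by (simp add: e_def)
  have "quad_fun Q q w = quad_fun Q q y + e \<bullet> (2 *\<^sub>R (Q *v y) + q) + e \<bullet> (Q *v e)"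
    using quad_fun_add[OF sym, of q y e] by (simp add: e_def)
  moreover have "0 \<le> e \<bullet> (Q *v e)"
    using psd by (simp add: pos_semidef_def)
  moreover have "0 \<le> e \<bullet> (2 *\<^sub>R (Q *v y) + q) + 2 * (e \<bullet> (c *\<^sub>R d - A *v d))"
    using jacobi_step_variational_inequality[OF sym X w y_def]
    by (simp add: A_def d_def e_def inner_add_right)
  ultimately show ?thesis
    unfolding polar Ne d_def[symmetric] by linarith
qed

section \<open>Convergence of proximal sequences\<close>

text \<open>
  \<open>N\<close> stands for the squared norm of the metric. For a minimizer \<open>w\<close> the three-point inequality makes
  \<open>N (x\<^sub>k - w)\<close> decreasing (Fejer monotonicity). Hence it converges, its decrements tend to 0, and these
  dominate \<open>F x\<^sub>k\<^sub>+\<^sub>1 - F w\<close>; so every cluster point \<open>xs\<close> minimizes \<open>F\<close>. Then \<open>N (x\<^sub>k - xs)\<close> also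
  converges, and its limit is 0 because it is 0 along a subsequence.
\<close>

lemma proximal_sequence_converges:
  fixes x :: "nat \<Rightarrow> 'a::euclidean_space" and F N :: "'a \<Rightarrow> real"
  assumes S: "compact S" and x_in: "\<And>k. x k \<in> S"
    and F: "continuous_on S F"
    and N: "continuous_on UNIV N" and N0: "N 0 = 0"
    and b: "b > 0" and N_lower: "\<And>u. b * (norm u)\<^sup>2 \<le> N u"
    and three_point: "\<And>k w. w \<in> S \<Longrightarrow>
      F (x (Suc k)) + N (x (Suc k) - x k) + N (x (Suc k) - w) \<le> F w + N (x k - w)"
  shows "\<exists>xs. is_arg_min F (\<lambda>x. x \<in> S) xs \<and> x \<longlonglongrightarrow> xs"
proof -
  have N_nonneg: "0 \<le> N u" for u
    using N_lower[of u] b by (meson mult_nonneg_nonneg order_trans less_imp_le zero_le_power2)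
  obtain w where w: "w \<in> S" and wmin: "\<And>u. u \<in> S \<Longrightarrow> F w \<le> F u"
    using continuous_attains_inf[OF S _ F] x_in by blast
  have decr: "N (x (Suc k) - u) + (F (x (Suc k)) - F u) \<le> N (x k - u)" if "u \<in> S" for u k
    using three_point[OF that, of k] N_nonneg[of "x (Suc k) - x k"] by linarith
  have conv: "convergent (\<lambda>k. N (x k - u))" if "u \<in> S" "\<And>v. v \<in> S \<Longrightarrow> F u \<le> F v" for u
  proof -
    have "decseq (\<lambda>k. N (x k - u))"
      using decr[OF that(1)] that(2)[OF x_in] by (intro decseq_SucI) (smt (verit))
    then show ?thesis
      using decseq_convergent[of _ 0] N_nonneg by (metis convergentI)
  qed
  have gap: "(\<lambda>k. F (x (Suc k))) \<longlonglongrightarrow> F w"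
  proof -
    obtain L where L: "(\<lambda>k. N (x k - w)) \<longlonglongrightarrow> L"
      using conv[OF w wmin] by (auto simp: convergent_def)
    have "(\<lambda>k. F w + (N (x k - w) - N (x (Suc k) - w))) \<longlonglongrightarrow> F w + (L - L)"
      by (intro tendsto_intros L LIMSEQ_Suc)
    then have upper: "(\<lambda>k. F w + (N (x k - w) - N (x (Suc k) - w))) \<longlonglongrightarrow> F w"
      by simp
    show ?thesis
    proof (rule tendsto_sandwich[OF _ _ tendsto_const upper])
      show "\<forall>\<^sub>F k in sequentially. F w \<le> F (x (Suc k))"
        using wmin x_in by simp
      show "\<forall>\<^sub>F k in sequentially. F (x (Suc k)) \<le> F w + (N (x k - w) - N (x (Suc k) - w))"
        using decr[OF w] by (intro always_eventually allI) (smt (verit))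
    qed
  qed
  obtain xs r where xs: "xs \<in> S" and r: "strict_mono r" and sub: "(x \<circ> r) \<longlonglongrightarrow> xs"
    using S x_in unfolding compact_def by metis
  have "(\<lambda>k. F ((x \<circ> r) k)) \<longlonglongrightarrow> F xs"
    using continuous_on_tendsto_compose[OF F sub xs] x_in by (simp add: o_def)
  moreover have "(\<lambda>k. F ((x \<circ> r) k)) \<longlonglongrightarrow> F w"
    using LIMSEQ_subseq_LIMSEQ[OF LIMSEQ_imp_Suc[OF gap] r] by (simp add: o_def)
  ultimately have "F xs = F w"
    by (rule LIMSEQ_unique)
  then have xs_min: "F xs \<le> F v" if "v \<in> S" for v
    using wmin[OF that] by simp
  obtain L where L: "(\<lambda>k. N (x k - xs)) \<longlonglongrightarrow> L"
    using conv[OF xs xs_min] by (auto simp: convergent_def)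
  have "(\<lambda>k. N ((x \<circ> r) k - xs)) \<longlonglongrightarrow> N (xs - xs)"
    by (rule continuous_on_tendsto_compose[OF N tendsto_diff[OF sub tendsto_const]]) auto
  moreover have "(\<lambda>k. N ((x \<circ> r) k - xs)) \<longlonglongrightarrow> L"
    using LIMSEQ_subseq_LIMSEQ[OF L r] by (simp add: o_def)
  ultimately have "L = 0"
    using LIMSEQ_unique N0 by fastforce
  have "(\<lambda>k. (norm (x k - xs))\<^sup>2) \<longlonglongrightarrow> 0"
  proof (rule tendsto_sandwich[OF _ _ tendsto_const])
    show "(\<lambda>k. N (x k - xs) / b) \<longlonglongrightarrow> 0"
      using tendsto_divide[OF L tendsto_const, of b] b \<open>L = 0\<close> by simp
    show "\<forall>\<^sub>F k in sequentially. (norm (x k - xs))\<^sup>2 \<le> N (x k - xs) / b"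
      using N_lower b by (simp add: pos_le_divide_eq mult.commute)
  qed simp
  then have "(\<lambda>k. sqrt ((norm (x k - xs))\<^sup>2)) \<longlonglongrightarrow> sqrt 0"
    by (rule tendsto_real_sqrt)
  then have "x \<longlonglongrightarrow> xs"
    by (simp add: LIM_zero_iff tendsto_norm_zero_iff)
  moreover have "is_arg_min F (\<lambda>x. x \<in> S) xs"
    using xs xs_min by (simp add: is_arg_min_linorder)
  ultimately show ?thesis by blast
qed

theorem theorem1:
  fixes Q :: "real^'n^'n" and q :: "real^'n"
    and blk :: "'n \<Rightarrow> 'm::finite" and X :: "'m \<Rightarrow> (real^'n) set"
    and c :: real and x0 :: "real^'n"
  assumes Q_sym: "transpose Q = Q"
    and Q_psd: "pos_semidef Q"
    and X_sub: "\<And>i. X i \<subseteq> block_space blk i"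
    and X_nonempty: "\<And>i. X i \<noteq> {}"
    and X_compact: "\<And>i. compact (X i)"
    and X_convex: "\<And>i. convex (X i)"
    and c_gt: "c > max_eigenvalue (Q - block_diag blk Q)"
    and x0_in: "x0 \<in> block_product blk X"
  shows "\<exists>xs. is_arg_min (quad_fun Q q) (\<lambda>x. x \<in> block_product blk X) xs \<and>
              jacobi_seq blk X (quad_fun Q q) c x0 \<longlonglongrightarrow> xs"
proof -
  define A where "A = Q - block_diag blk Q"
  define N where "N = (\<lambda>u. c * (u \<bullet> u) - u \<bullet> (A *v u))"
  have symA: "transpose A = A"
    using Q_sym by (simp add: A_def block_diag_def transpose_def vec_eq_iff)
  show ?thesis
  proof (rule proximal_sequence_converges[where N = N and b = "c - max_eigenvalue A"])
    show "compact (block_product blk X)"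
      by (rule compact_block_product[OF X_sub X_compact])
    show "jacobi_seq blk X (quad_fun Q q) c x0 k \<in> block_product blk X" for k
      by (cases k) (simp_all add: x0_in jacobi_step_in_block_product X_sub X_nonempty X_compact)
    show "continuous_on (block_product blk X) (quad_fun Q q)"
      by (rule continuous_on_quad_fun)
    show "continuous_on UNIV N"
      unfolding N_def
      by (intro continuous_intros linear_continuous_on_compose[OF continuous_on_id]) simp
    show "N 0 = 0"
      by (simp add: N_def)
    show "0 < c - max_eigenvalue A"
      using c_gt by (simp add: A_def)
    show "(c - max_eigenvalue A) * (norm u)\<^sup>2 \<le> N u" for u
      using inner_le_max_eigenvalue[OF symA, of u]
      by (simp add: N_def power2_norm_eq_inner algebra_simps)
    show "quad_fun Q q (jacobi_seq blk X (quad_fun Q q) c x0 (Suc k))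
        + N (jacobi_seq blk X (quad_fun Q q) c x0 (Suc k) - jacobi_seq blk X (quad_fun Q q) c x0 k)
        + N (jacobi_seq blk X (quad_fun Q q) c x0 (Suc k) - w)
        \<le> quad_fun Q q w + N (jacobi_seq blk X (quad_fun Q q) c x0 k - w)"
      if "w \<in> block_product blk X" for k w
      unfolding jacobi_seq.simps
      by (rule jacobi_step_three_point[OF Q_sym Q_psd X_sub X_nonempty X_compact X_convex that refl])
        (simp add: N_def A_def)
  qed
qed

end
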